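(* Let $\alpha\in(0,1)$. Let $Y$ and $Z$ be random vectors with known discrete marginal distributions: $Y$ takes the distinct values $y_1,\dots,y_M$ with $\mathbb{P}(Y=y_m)=p_m$, and $Z$ takes the distinct values $z_1,\dots,z_N$ with $\mathbb{P}(Z=z_n)=q_n$, where $p_m,q_n\ge 0$, $\sum_{m=1}^M p_m=1$ and $\sum_{n=1}^N q_n=1$. Let $L=L(Y,Z)$ be a real-valued (possibly nonlinear) loss function and put $L_{mn}=L(y_m,z_n)$. Let $\mathfrak{F}(F_Y,F_Z)$ be the set of all joint distributions of $(Y,Z)$ with these marginals, each identified with a matrix $\psi=(\psi_{mn})$, $\psi_{mn}=\mathbb{P}(Y=y_m,Z=z_n)$. Then the worst-case CVaR problem $$\max_{\psi\in\mathfrak{F}(F_Y,F_Z)}\ \mathrm{CVaR}_\alpha\big(L(Y,Z)\big)$$ is equivalent to the linear program, in the variables $\psi=(\psi_{mn})$ and $\mu=(\mu_{mn})$, $$\begin{aligned} \max_{\psi,\mu}\quad & \frac{1}{1-\alpha}\sum_{m=1}^M\sum_{n=1}^N L_{mn}\,\mu_{mn}\\ \text{subject to}\quad & \sum_{n=1}^N\psi_{mn}=p_m,\quad m=1,\dots,M,\\ & \sum_{m=1}^M\psi_{mn}=q_n,\quad n=1,\dots,N,\\ & \sum_{m=1}^M\sum_{n=1}^N\mu_{mn}=1-\alpha,\\ & 0\le\mu_{mn}\le\psi_{mn},\quad m=1,\dots,M,\ n=1,\dots,N. \end{aligned}$$ That is, the two problems have the same optimal value, and if $(\psi,\mu)$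 is an optimal solution of the linear program, then $\psi$ is a worst-case joint distribution, i.e. it attains the maximum of $\mathrm{CVaR}_\alpha(L(Y,Z))$ over $\mathfrak{F}(F_Y,F_Z)$.
   Context: For a loss random variable $L$ and $\xi\in(0,1)$, the Value-at-Risk $\mathrm{VaR}_\xi(L)$ is the $\xi$-quantile of the distribution of $L$, i.e. $\mathrm{VaR}_\xi(L)=\inf\{x\in\mathbb{R}:\mathbb{P}(L\le x)\ge\xi\}$. The Conditional Value at Risk at confidence level $\alpha\in(0,1)$ is $$\mathrm{CVaR}_\alpha(L)=\frac{1}{1-\alpha}\int_\alpha^1\mathrm{VaR}_\xi(L)\,d\xi .$$ For a joint distribution $\psi$ of $(Y,Z)$, $\mathrm{CVaR}_\alpha(L(Y,Z))$ is computed from the distribution of $L(Y,Z)$ under $\psi$. *)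

theory Defs
  imports "HOL-Probability.Probability"
begin

definition VaR :: "'a measure \<Rightarrow> ('a \<Rightarrow> real) \<Rightarrow> real \<Rightarrow> real" where
  "VaR M X \<xi> = Inf {x. \<P>(\<omega> in M. X \<omega> \<le> x) \<ge> \<xi>}"

definition CVaR :: "'a measure \<Rightarrow> ('a \<Rightarrow> real) \<Rightarrow> real \<Rightarrow> real" where
  "CVaR M X \<alpha> = 1 / (1 - \<alpha>) * (LINT \<xi>:{\<alpha><..<1}|lborel. VaR M X \<xi>)"

text \<open>Every coupling of two discrete distributions is itself discrete, so ranging over
  \<open>pmf\<close>s loses no joint distribution.\<close>

definition Frechet_class :: "'a pmf \<Rightarrow> 'b pmf \<Rightarrow> ('a \<times> 'b) pmf set" where
  "Frechet_class F G = {\<Psi>. map_pmf fst \<Psi> = F \<and> map_pmf snd \<Psi> = G}"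

definition joint_CVaR :: "('a \<Rightarrow> 'b \<Rightarrow> real) \<Rightarrow> real \<Rightarrow> ('a \<times> 'b) pmf \<Rightarrow> real" where
  "joint_CVaR L \<alpha> \<Psi> = CVaR (measure_pmf \<Psi>) (\<lambda>(y, z). L y z) \<alpha>"

definition joint_matrix ::
  "('m::finite \<Rightarrow> 'a) \<Rightarrow> ('n::finite \<Rightarrow> 'b) \<Rightarrow> ('a \<times> 'b) pmf \<Rightarrow> real ^ 'n ^ 'm" where
  "joint_matrix y z \<Psi> = (\<chi> m n. pmf \<Psi> (y m, z n))"

definition LP_feasible ::
  "real \<Rightarrow> ('m::finite \<Rightarrow> real) \<Rightarrow> ('n::finite \<Rightarrow> real) \<Rightarrow>
    (real ^ 'n ^ 'm) \<times> (real ^ 'n ^ 'm) \<Rightarrow> bool" where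
  "LP_feasible \<alpha> p q = (\<lambda>(\<psi>, \<mu>).
     (\<forall>m. (\<Sum>n\<in>UNIV. \<psi> $ m $ n) = p m) \<and>
     (\<forall>n. (\<Sum>m\<in>UNIV. \<psi> $ m $ n) = q n) \<and>
     (\<Sum>m\<in>UNIV. \<Sum>n\<in>UNIV. \<mu> $ m $ n) = 1 - \<alpha> \<and>
     (\<forall>m n. 0 \<le> \<mu> $ m $ n \<and> \<mu> $ m $ n \<le> \<psi> $ m $ n))"

definition LP_objective ::
  "real \<Rightarrow> ('m::finite \<Rightarrow> 'n::finite \<Rightarrow> real) \<Rightarrow>
    (real ^ 'n ^ 'm) \<times> (real ^ 'n ^ 'm) \<Rightarrow> real" where
  "LP_objective \<alpha> \<Lambda> = (\<lambda>(\<psi>, \<mu>).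
     1 / (1 - \<alpha>) * (\<Sum>m\<in>UNIV. \<Sum>n\<in>UNIV. \<Lambda> m n * \<mu> $ m $ n))"

end

theory Submission
  imports Defs
begin

text \<open>The function \<open>\<xi> \<mapsto> VaR\<^sub>\<xi>\<close> on \<open>(0, 1)\<close> with Lebesgue measure has the same distribution
  as \<open>X\<close>. Being monotone, with \<open>v = VaR\<^sub>\<alpha>\<close> it satisfies \<open>VaR\<^sub>\<xi> - v = max (VaR\<^sub>\<xi> - v) 0\<close> for
  \<open>\<xi> > \<alpha>\<close>, while the right-hand side vanishes for \<open>\<xi> < \<alpha>\<close>, so
  \<open>(1 - \<alpha>) CVaR\<^sub>\<alpha> = (1 - \<alpha>) v + E (max (X - v) 0)\<close>. On a finite space this shows that
  \<open>(1 - \<alpha>) CVaR\<^sub>\<alpha>\<close> is the maximum of \<open>\<Sum> X \<mu>\<close> over all \<open>0 \<le> \<mu> \<le> \<psi>\<close> of mass \<open>1 - \<alpha>\<close>, attained by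
  taking all of \<open>\<psi>\<close> above \<open>v\<close> and a suitable fraction of it at \<open>v\<close>. Maximising over \<open>\<psi>\<close> as well
  gives the linear program, whose feasible set is compact.\<close>

section \<open>Value at Risk and the Rockafellar--Uryasev formula\<close>

context prob_space
begin

lemma cdf_distribution_distr:
  "X \<in> borel_measurable M \<Longrightarrow> cdf_distribution (distr M borel X)"
  by (simp add: cdf_distribution_def)

lemma cdf_distr:
  assumes "X \<in> borel_measurable M"
  shows "cdf (distr M borel X) x = \<P>(\<omega> in M. X \<omega> \<le> x)"
  using assms by (auto simp: cdf_def measure_distr vimage_def intro!: arg_cong[where f="measure M"])

lemma VaR_eq_Inf_cdf:
  assumes "X \<in> borel_measurable M"
  shows "VaR M X \<xi> = Inf {x. \<xi> \<le> cdf (distr M borel X) x}"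
  by (simp add: VaR_def cdf_distr[OF assms])

text \<open>Right-continuity of the distribution function makes the infimum attained, so quantile
  and distribution function form a Galois connection.\<close>

lemma VaR_le_iff:
  assumes "X \<in> borel_measurable M" and "0 < \<xi>" "\<xi> < 1"
  shows "VaR M X \<xi> \<le> x \<longleftrightarrow> \<xi> \<le> \<P>(\<omega> in M. X \<omega> \<le> x)"
proof -
  interpret D: cdf_distribution "distr M borel X"
    by (rule cdf_distribution_distr) fact
  show ?thesis
    using D.pseudoinverse[OF assms(2,3), of x]
    by (simp only: VaR_eq_Inf_cdf[OF assms(1)] cdf_distr[OF assms(1)])
qed

lemma VaR_mono:
  assumes "X \<in> borel_measurable M" and "0 < \<xi>" "\<xi> \<le> \<eta>" "\<eta> < 1"
  shows "VaR M X \<xi> \<le> VaR M X \<eta>"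
proof -
  have "\<eta> \<le> \<P>(\<omega> in M. X \<omega> \<le> VaR M X \<eta>)"
    using VaR_le_iff[OF assms(1), of \<eta> "VaR M X \<eta>"] assms by simp
  then show ?thesis
    using VaR_le_iff[OF assms(1), of \<xi> "VaR M X \<eta>"] assms by simp
qed

text \<open>Every point below the quantile has cumulative probability below \<xi>. Letting the point
  increase to the quantile gives the bound, since the left limit of the distribution function is the
  mass of the open half-line.\<close>

lemma prob_less_VaR:
  assumes X: "X \<in> borel_measurable M" and "0 < \<xi>" "\<xi> < 1"
  shows "\<P>(\<omega> in M. X \<omega> < VaR M X \<xi>) \<le> \<xi>"
proof -
  let ?D = "distr M borel X" and ?v = "VaR M X \<xi>"
  interpret D: cdf_distribution ?D
    by (rule cdf_distribution_distr) fact
  have "measure ?D {..<?v} \<le> \<xi>"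
  proof (rule tendsto_upperbound[OF D.cdf_at_left])
    have "cdf ?D x \<le> \<xi>" if "x < ?v" for x
      using VaR_le_iff[OF assms, of x] that cdf_distr[OF X, of x] by linarith
    then show "\<forall>\<^sub>F x in at_left ?v. cdf ?D x \<le> \<xi>"
      by (simp add: eventually_at_filter)
  qed simp
  also have "measure ?D {..<?v} = \<P>(\<omega> in M. X \<omega> < ?v)"
    using X by (auto simp: measure_distr vimage_def intro!: arg_cong[where f="measure M"])
  finally show ?thesis .
qed

text \<open>This is the quantile transform: the pseudo-inverse of a distribution function pushes the
  uniform law on (0, 1) forward to the original law.\<close>

lemma distr_VaR:
  assumes "X \<in> borel_measurable M"
  shows "VaR M X \<in> borel_measurable (restrict_space lborel {0<..<1})"
    and "distr (restrict_space lborel {0<..<1}) borel (VaR M X) = distr M borel X"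
proof -
  interpret D: cdf_distribution "distr M borel X"
    by (rule cdf_distribution_distr) fact
  have eq: "VaR M X = (\<lambda>\<xi>. Inf {x. \<xi> \<le> cdf (distr M borel X) x})"
    by (rule ext) (rule VaR_eq_Inf_cdf[OF assms])
  have "sets (restrict_space lborel {0<..<1::real}) = sets (restrict_space borel {0<..<1})"
    by (simp add: sets_restrict_space)
  then show "VaR M X \<in> borel_measurable (restrict_space lborel {0<..<1})"
    using D.measurable_CI unfolding eq by (simp cong: measurable_cong_sets)
  show "distr (restrict_space lborel {0<..<1}) borel (VaR M X) = distr M borel X"
    unfolding eq by (rule D.distr_I_eq_M)
qed

lemma set_integral_comp_VaR:
  fixes f :: "real \<Rightarrow> real"
  assumes X: "X \<in> borel_measurable M" and f: "f \<in> borel_measurable borel"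
  shows "(LINT \<xi>:{0<..<1}|lborel. f (VaR M X \<xi>)) = expectation (\<lambda>\<omega>. f (X \<omega>))"
    and "integrable M (\<lambda>\<omega>. f (X \<omega>)) \<Longrightarrow>
      set_integrable lborel {0<..<1} (\<lambda>\<xi>. f (VaR M X \<xi>))"
proof -
  let ?\<Omega> = "restrict_space lborel {0<..<1::real}"
  have "(LINT \<xi>:{0<..<1}|lborel. f (VaR M X \<xi>)) = (LINT \<xi>|?\<Omega>. f (VaR M X \<xi>))"
    by (simp add: set_lebesgue_integral_def integral_restrict_space)
  also have "\<dots> = integral\<^sup>L (distr ?\<Omega> borel (VaR M X)) f"
    using distr_VaR(1)[OF X] f by (simp add: integral_distr)
  also have "\<dots> = expectation (\<lambda>\<omega>. f (X \<omega>))"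
    unfolding distr_VaR(2)[OF X] using X f by (simp add: integral_distr)
  finally show "(LINT \<xi>:{0<..<1}|lborel. f (VaR M X \<xi>)) = expectation (\<lambda>\<omega>. f (X \<omega>))" .
  assume "integrable M (\<lambda>\<omega>. f (X \<omega>))"
  then have "integrable (distr ?\<Omega> borel (VaR M X)) f"
    unfolding distr_VaR(2)[OF X] using X f by (simp add: integrable_distr_eq)
  then have "integrable ?\<Omega> (\<lambda>\<xi>. f (VaR M X \<xi>))"
    using distr_VaR(1)[OF X] f by (simp add: integrable_distr_eq)
  then show "set_integrable lborel {0<..<1} (\<lambda>\<xi>. f (VaR M X \<xi>))"
    by (simp add: set_integrable_def integrable_restrict_space)
qed

lemma CVaR_eq_expectation_excess:
  assumes X: "integrable M X" and \<alpha>: "0 < \<alpha>" "\<alpha> < 1"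
  shows "(1 - \<alpha>) * CVaR M X \<alpha> =
    (1 - \<alpha>) * VaR M X \<alpha> + expectation (\<lambda>\<omega>. max (X \<omega> - VaR M X \<alpha>) 0)"
proof -
  let ?v = "VaR M X \<alpha>"
  have Xm: "X \<in> borel_measurable M"
    using X by simp
  have "set_integrable lborel {0<..<1} (VaR M X)"
    using set_integral_comp_VaR(2)[OF Xm, of "\<lambda>x. x"] X by simp
  then have int: "set_integrable lborel {\<alpha><..<1} (VaR M X)"
    by (rule set_integrable_subset) (use \<alpha> in auto)
  have "(LINT \<xi>:{\<alpha><..<1}|lborel. VaR M X \<xi>) - (1 - \<alpha>) * ?v =
      (LINT \<xi>:{\<alpha><..<1}|lborel. VaR M X \<xi> - ?v)"
    using int \<alpha> by (subst set_integral_diff(2)) (auto simp: set_integrable_def set_lebesgue_integral_def)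
  also have "\<dots> = (LINT \<xi>:{0<..<1}|lborel. max (VaR M X \<xi> - ?v) 0)"
    unfolding set_lebesgue_integral_def
  proof (intro Bochner_Integration.integral_cong refl)
    fix \<xi> :: real
    show "indicat_real {\<alpha><..<1} \<xi> *\<^sub>R (VaR M X \<xi> - ?v) =
        indicat_real {0<..<1} \<xi> *\<^sub>R max (VaR M X \<xi> - ?v) 0"
      using VaR_mono[OF Xm, of \<xi> \<alpha>] VaR_mono[OF Xm, of \<alpha> \<xi>] \<alpha>
      by (cases "\<xi> \<le> \<alpha>") (auto simp: indicator_def max_def)
  qed
  also have "\<dots> = expectation (\<lambda>\<omega>. max (X \<omega> - ?v) 0)"
    by (rule set_integral_comp_VaR(1)[OF Xm, of "\<lambda>x. max (x - ?v) 0"]) measurable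
  finally show ?thesis
    using \<alpha> by (simp add: CVaR_def)
qed

end

section \<open>CVaR on a finite space as a linear program\<close>

lemma measure_pmf_eq_sum:
  fixes R :: "'a::finite pmf"
  shows "measure (measure_pmf R) {x. P x} = (\<Sum>x\<in>UNIV. if P x then pmf R x else 0)"
  by (simp add: measure_measure_pmf_finite sum.If_cases)

lemma CVaR_eq_sum:
  fixes R :: "'a::finite pmf" and X :: "'a \<Rightarrow> real"
  assumes "0 < \<alpha>" "\<alpha> < 1"
  shows "(1 - \<alpha>) * CVaR (measure_pmf R) X \<alpha> =
    (1 - \<alpha>) * VaR (measure_pmf R) X \<alpha> +
    (\<Sum>x\<in>UNIV. max (X x - VaR (measure_pmf R) X \<alpha>) 0 * pmf R x)"
proof -
  have "integrable (measure_pmf R) X"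
    by (rule integrable_measure_pmf_finite) simp
  from measure_pmf.CVaR_eq_expectation_excess[OF this assms] show ?thesis
    by (simp add: integral_measure_pmf_real[of UNIV])
qed

text \<open>As \<open>\<mu>\<close> has mass 1 - \<alpha>, centring \<open>X\<close> at its quantile
  v splits off exactly (1 - \<alpha>) v. Each remaining term can only grow when
  \<open>X x - v\<close> is replaced by its positive part and \<open>\<mu> x\<close> by
  \<open>pmf R x\<close>.\<close>

lemma sum_le_CVaR:
  fixes R :: "'a::finite pmf" and X \<mu> :: "'a \<Rightarrow> real"
  assumes \<alpha>: "0 < \<alpha>" "\<alpha> < 1"
    and \<mu>: "\<And>x. 0 \<le> \<mu> x" "\<And>x. \<mu> x \<le> pmf R x" "(\<Sum>x\<in>UNIV. \<mu> x) = 1 - \<alpha>"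
  shows "(\<Sum>x\<in>UNIV. X x * \<mu> x) \<le> (1 - \<alpha>) * CVaR (measure_pmf R) X \<alpha>"
proof -
  let ?v = "VaR (measure_pmf R) X \<alpha>"
  have "(\<Sum>x\<in>UNIV. X x * \<mu> x) = (1 - \<alpha>) * ?v + (\<Sum>x\<in>UNIV. (X x - ?v) * \<mu> x)"
    by (simp add: algebra_simps sum_subtractf \<mu>(3)[symmetric] sum_distrib_left sum_distrib_right)
  also have "(\<Sum>x\<in>UNIV. (X x - ?v) * \<mu> x) \<le> (\<Sum>x\<in>UNIV. max (X x - ?v) 0 * pmf R x)"
    by (intro sum_mono mult_mono' order_trans[OF mult_right_mono mult_left_mono])
       (auto simp: \<mu>)
  finally show ?thesis
    by (simp add: CVaR_eq_sum[OF \<alpha>])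
qed

lemma CVaR_attained:
  fixes R :: "'a::finite pmf" and X :: "'a \<Rightarrow> real"
  assumes \<alpha>: "0 < \<alpha>" "\<alpha> < 1"
  obtains \<mu> where "\<And>x. 0 \<le> \<mu> x" "\<And>x. \<mu> x \<le> pmf R x" "(\<Sum>x\<in>UNIV. \<mu> x) = 1 - \<alpha>"
    and "(\<Sum>x\<in>UNIV. X x * \<mu> x) = (1 - \<alpha>) * CVaR (measure_pmf R) X \<alpha>"
proof -
  let ?v = "VaR (measure_pmf R) X \<alpha>"
  \<comment> \<open>\<open>G\<close> and \<open>E\<close> are the masses strictly above and exactly
    at the quantile. The two quantile inequalities give
    \<open>G \<le> 1 - \<alpha> \<le> G + E\<close>, which leaves room for a weight of mass 1 -
    \<alpha>.\<close>
  define G where "G = (\<Sum>x\<in>UNIV. if ?v < X x then pmf R x else 0)"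
  define E where "E = (\<Sum>x\<in>UNIV. if X x = ?v then pmf R x else 0)"
  have "1 = (\<Sum>x\<in>UNIV. pmf R x)"
    by (simp add: sum_pmf_eq_1)
  also have "\<dots> = measure (measure_pmf R) {x. X x \<le> ?v} + G"
    unfolding G_def measure_pmf_eq_sum sum.distrib[symmetric] by (rule sum.cong) auto
  finally have G: "G \<le> 1 - \<alpha>"
    using measure_pmf.VaR_le_iff[of X R \<alpha> ?v] \<alpha> by simp
  have "1 = (\<Sum>x\<in>UNIV. pmf R x)"
    by (simp add: sum_pmf_eq_1)
  also have "\<dots> = measure (measure_pmf R) {x. X x < ?v} + (G + E)"
    unfolding G_def E_def measure_pmf_eq_sum sum.distrib[symmetric] by (rule sum.cong) auto
  finally have GE: "1 - \<alpha> \<le> G + E"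
    using measure_pmf.prob_less_VaR[of X R \<alpha>] \<alpha> by simp
  \<comment> \<open>The atom at the quantile is split so that the total mass becomes \<open>1 - \<alpha>\<close>;
    if \<open>E = 0\<close>, then \<open>G = 1 - \<alpha>\<close> and \<open>t = 0 / 0 = 0\<close>.\<close>
  define t where "t = (1 - \<alpha> - G) / E"
  have "0 \<le> E"
    unfolding E_def by (intro sum_nonneg) auto
  with G GE have t: "0 \<le> t" "t \<le> 1" "G + t * E = 1 - \<alpha>"
    by (auto simp: t_def divide_simps)
  define \<mu> where "\<mu> x = (if ?v < X x then pmf R x else 0) + t * (if X x = ?v then pmf R x else 0)" for x
  have sum: "(\<Sum>x\<in>UNIV. \<mu> x) = 1 - \<alpha>"
    by (simp add: \<mu>_def sum.distrib sum_distrib_left[symmetric] G_def[symmetric] E_def[symmetric] t)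
  have "(\<Sum>x\<in>UNIV. X x * \<mu> x) = (1 - \<alpha>) * ?v + (\<Sum>x\<in>UNIV. (X x - ?v) * \<mu> x)"
    by (simp add: algebra_simps sum_subtractf sum[symmetric] sum_distrib_left sum_distrib_right)
  \<comment> \<open>At the atom the factor \<open>X x - ?v\<close> vanishes, so the share
    \<open>t\<close> changes the mass but not this sum.\<close>
  also have "(\<Sum>x\<in>UNIV. (X x - ?v) * \<mu> x) = (\<Sum>x\<in>UNIV. max (X x - ?v) 0 * pmf R x)"
    by (rule sum.cong) (auto simp: \<mu>_def)
  finally have "(\<Sum>x\<in>UNIV. X x * \<mu> x) = (1 - \<alpha>) * CVaR (measure_pmf R) X \<alpha>"
    by (simp add: CVaR_eq_sum[OF \<alpha>])
  moreover have "0 \<le> \<mu> x" "\<mu> x \<le> pmf R x" for x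
    using t(1,2) mult_right_mono[OF t(2), of "pmf R x"] by (auto simp: \<mu>_def)
  ultimately show thesis
    using that sum by blast
qed

section \<open>Couplings with finitely supported marginals\<close>

lemma ex_pmf_of_weights:
  fixes w :: "'a::finite \<Rightarrow> real"
  assumes "\<And>x. 0 \<le> w x" "(\<Sum>x\<in>UNIV. w x) = 1"
  obtains R where "pmf R = w"
proof
  show "pmf (embed_pmf w) = w"
    using assms by (intro ext pmf_embed_pmf)
      (auto simp: nn_integral_count_space_finite sum_ennreal)
qed

lemma pmf_map_fst:
  fixes R :: "('a::finite \<times> 'b::finite) pmf"
  shows "pmf (map_pmf fst R) a = (\<Sum>b\<in>UNIV. pmf R (a, b))"
proof -
  have "fst -` {a} = Pair a ` (UNIV :: 'b set)"
    by auto
  then show ?thesis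
    by (simp add: pmf_map measure_measure_pmf_finite sum.reindex inj_on_def)
qed

lemma pmf_map_snd:
  fixes R :: "('a::finite \<times> 'b::finite) pmf"
  shows "pmf (map_pmf snd R) b = (\<Sum>a\<in>UNIV. pmf R (a, b))"
proof -
  have "snd -` {b} = (\<lambda>a. (a, b)) ` (UNIV :: 'a set)"
    by auto
  then show ?thesis
    by (simp add: pmf_map measure_measure_pmf_finite sum.reindex inj_on_def)
qed

text \<open>Replaces a marginal on vectors by one on a finite index type, where all sums run over
  \<open>UNIV\<close>. The masses at the distinct points \<open>f i\<close> already add up to 1, so
  \<open>F\<close> lives on the range of \<open>f\<close>.\<close>

lemma ex_pmf_on_indices:
  fixes f :: "'i::finite \<Rightarrow> 'a"
  assumes f: "inj f" and F: "\<And>i. pmf F (f i) = w i" "(\<Sum>i\<in>UNIV. w i) = 1"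
  obtains P where "F = map_pmf f P" "pmf P = w"
proof -
  have "0 \<le> w i" for i
    unfolding F(1)[symmetric] by simp
  then obtain P where P: "pmf P = w"
    using F(2) by (rule ex_pmf_of_weights)
  have "measure F (range f) = 1"
    using F f by (simp add: measure_measure_pmf_finite sum.reindex)
  then have supp: "set_pmf F \<subseteq> range f"
    by (auto simp: measure_pmf.prob_eq_1 AE_measure_pmf_iff)
  have "F = map_pmf f P"
  proof (rule pmf_eqI)
    fix x
    show "pmf F x = pmf (map_pmf f P) x"
    proof (cases "x \<in> range f")
      case True
      then show ?thesis
        using F(1) by (auto simp: pmf_map_inj'[OF f] P)
    next
      case False
      then show ?thesis
        using supp by (metis pmf_map_outside image_mono subset_UNIV in_mono pmf_eq_0_set_pmf)
    qed
  qed
  with P show thesis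
    by (rule that[rotated])
qed

text \<open>The support of a coupling projects onto the supports of its marginals, hence lies in the
  product of the two ranges. There \<open>inv f\<close> and \<open>inv g\<close> undo the
  relabelling, so every coupling comes from one on the indices.\<close>

lemma Frechet_class_map_pmf:
  assumes "inj f" "inj g"
  shows "Frechet_class (map_pmf f P) (map_pmf g Q) = map_pmf (map_prod f g) ` Frechet_class P Q"
proof (intro equalityI subsetI)
  fix \<Psi> assume \<Psi>: "\<Psi> \<in> Frechet_class (map_pmf f P) (map_pmf g Q)"
  let ?R = "map_pmf (map_prod (inv f) (inv g)) \<Psi>"
  have fst: "map_pmf fst \<Psi> = map_pmf f P" and snd: "map_pmf snd \<Psi> = map_pmf g Q"
    using \<Psi> by (auto simp: Frechet_class_def)
  have "fst ` set_pmf \<Psi> \<subseteq> range f" "snd ` set_pmf \<Psi> \<subseteq> range g"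
    unfolding set_map_pmf[symmetric] fst snd by auto
  then have "map_pmf (map_prod f g) ?R = map_pmf (\<lambda>x. x) \<Psi>"
    unfolding pmf.map_comp by (intro map_pmf_cong refl) (force simp: f_inv_into_f)
  then have "\<Psi> = map_pmf (map_prod f g) ?R"
    by simp
  moreover have "map_pmf fst ?R = P"
  proof -
    have "map_pmf fst ?R = map_pmf (inv f) (map_pmf fst \<Psi>)"
      by (simp add: pmf.map_comp o_def)
    then show ?thesis
      using assms by (simp add: fst pmf.map_comp)
  qed
  moreover have "map_pmf snd ?R = Q"
  proof -
    have "map_pmf snd ?R = map_pmf (inv g) (map_pmf snd \<Psi>)"
      by (simp add: pmf.map_comp o_def)
    then show ?thesis
      using assms by (simp add: snd pmf.map_comp)
  qed
  ultimately show "\<Psi> \<in> map_pmf (map_prod f g) ` Frechet_class P Q"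
    unfolding Frechet_class_def by blast
next
  fix \<Psi> assume "\<Psi> \<in> map_pmf (map_prod f g) ` Frechet_class P Q"
  then show "\<Psi> \<in> Frechet_class (map_pmf f P) (map_pmf g Q)"
    by (auto simp: Frechet_class_def pmf.map_comp o_def)
qed

text \<open>CVaR sees the joint law only through the distribution of the loss, which is unchanged
  when the relabelling is absorbed into the loss function.\<close>

lemma joint_CVaR_map_pmf:
  "joint_CVaR L \<alpha> (map_pmf (map_prod f g) R) = joint_CVaR (\<lambda>i j. L (f i) (g j)) \<alpha> R"
  by (simp add: joint_CVaR_def CVaR_def VaR_def vimage_def case_prod_beta)

lemma joint_matrix_map_pmf:
  assumes "inj f" "inj g"
  shows "joint_matrix f g (map_pmf (map_prod f g) R) = (\<chi> i j. pmf R (i, j))"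
proof -
  have "pmf (map_pmf (map_prod f g) R) (f i, g j) = pmf R (i, j)" for i j
    using pmf_map_inj'[OF prod.inj_map[OF assms], of R "(i, j)"] by simp
  then show ?thesis
    by (simp add: joint_matrix_def)
qed

section \<open>The linear program\<close>

lemma sum_UNIV_prod: "(\<Sum>x\<in>UNIV. h x) = (\<Sum>i\<in>UNIV. \<Sum>j\<in>UNIV. h (i, j))"
  by (simp add: sum.cartesian_product)

lemma LP_objective_le_joint_CVaR:
  fixes R :: "('m::finite \<times> 'n::finite) pmf"
  assumes \<alpha>: "0 < \<alpha>" "\<alpha> < 1" and feas: "LP_feasible \<alpha> p q (\<chi> i j. pmf R (i, j), \<mu>)"
  shows "LP_objective \<alpha> \<Lambda> (\<chi> i j. pmf R (i, j), \<mu>) \<le> joint_CVaR \<Lambda> \<alpha> R"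
proof -
  have "(\<Sum>x\<in>UNIV. (\<lambda>(i, j). \<Lambda> i j) x * (\<lambda>(i, j). \<mu> $ i $ j) x) \<le>
      (1 - \<alpha>) * CVaR (measure_pmf R) (\<lambda>(i, j). \<Lambda> i j) \<alpha>"
    using feas by (intro sum_le_CVaR[OF \<alpha>]) (auto simp: LP_feasible_def sum_UNIV_prod)
  then show ?thesis
    using \<alpha> by (simp add: LP_objective_def joint_CVaR_def sum_UNIV_prod field_simps)
qed

text \<open>Together with \<open>LP_objective_le_joint_CVaR\<close> this identifies the CVaR of a
  fixed coupling as the maximum of the objective over \<open>\<mu>\<close> alone.\<close>

lemma joint_CVaR_eq_LP_objective:
  fixes R :: "('m::finite \<times> 'n::finite) pmf"
  assumes \<alpha>: "0 < \<alpha>" "\<alpha> < 1" and R: "R \<in> Frechet_class P Q"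
  obtains \<mu> where "LP_feasible \<alpha> (pmf P) (pmf Q) (\<chi> i j. pmf R (i, j), \<mu>)"
    "joint_CVaR \<Lambda> \<alpha> R = LP_objective \<alpha> \<Lambda> (\<chi> i j. pmf R (i, j), \<mu>)"
proof -
  obtain \<mu> where \<mu>: "\<And>x. 0 \<le> \<mu> x" "\<And>x. \<mu> x \<le> pmf R x" "(\<Sum>x\<in>UNIV. \<mu> x) = 1 - \<alpha>"
    "(\<Sum>x\<in>UNIV. (\<lambda>(i, j). \<Lambda> i j) x * \<mu> x) = (1 - \<alpha>) * CVaR (measure_pmf R) (\<lambda>(i, j). \<Lambda> i j) \<alpha>"
    using CVaR_attained[OF \<alpha>, of R "\<lambda>(i, j). \<Lambda> i j"] by blast
  have "map_pmf fst R = P" "map_pmf snd R = Q"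
    using R by (auto simp: Frechet_class_def)
  then have "LP_feasible \<alpha> (pmf P) (pmf Q) (\<chi> i j. pmf R (i, j), \<chi> i j. \<mu> (i, j))"
    using \<mu> by (auto simp: LP_feasible_def sum_UNIV_prod simp flip: pmf_map_fst pmf_map_snd)
  moreover have "joint_CVaR \<Lambda> \<alpha> R = LP_objective \<alpha> \<Lambda> (\<chi> i j. pmf R (i, j), \<chi> i j. \<mu> (i, j))"
    using \<mu>(4) \<alpha> by (simp add: LP_objective_def joint_CVaR_def sum_UNIV_prod field_simps)
  ultimately show thesis
    by (rule that)
qed

lemma LP_feasible_coupling:
  fixes P :: "'m::finite pmf" and Q :: "'n::finite pmf"
  assumes "LP_feasible \<alpha> (pmf P) (pmf Q) (\<psi>, \<mu>)"
  obtains R where "R \<in> Frechet_class P Q" "\<psi> = (\<chi> i j. pmf R (i, j))"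
proof -
  \<comment> \<open>Nonnegativity of \<open>\<psi>\<close> is implicit in the program: it follows
    from \<open>0 \<le> \<mu> \<le> \<psi>\<close> entrywise.\<close>
  have \<psi>: "0 \<le> \<psi> $ i $ j" "(\<Sum>j\<in>UNIV. \<psi> $ i $ j) = pmf P i" "(\<Sum>i\<in>UNIV. \<psi> $ i $ j) = pmf Q j" for i j
    using assms by (auto simp: LP_feasible_def) (meson order_trans)
  have "(\<Sum>x\<in>UNIV. (\<lambda>(i, j). \<psi> $ i $ j) x) = 1"
    by (simp add: sum_UNIV_prod \<psi> sum_pmf_eq_1)
  then obtain R where R: "pmf R = (\<lambda>(i, j). \<psi> $ i $ j)"
    using \<psi>(1) by (auto intro: ex_pmf_of_weights[of "\<lambda>(i, j). \<psi> $ i $ j"])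
  show thesis
  proof
    show "R \<in> Frechet_class P Q"
      by (auto simp: Frechet_class_def pmf_map_fst pmf_map_snd R \<psi> intro!: pmf_eqI)
    show "\<psi> = (\<chi> i j. pmf R (i, j))"
      by (simp add: R vec_eq_iff)
  qed
qed

lemma compact_LP_feasible:
  fixes p :: "'m::finite \<Rightarrow> real" and q :: "'n::finite \<Rightarrow> real"
  shows "compact (Collect (LP_feasible \<alpha> p q))"
proof (rule compact_eq_bounded_closed[THEN iffD2], rule conjI)
  have eq: "Collect (LP_feasible \<alpha> p q) =
    {x. (\<forall>m. (\<Sum>n\<in>UNIV. fst x $ m $ n) = p m) \<and> (\<forall>n. (\<Sum>m\<in>UNIV. fst x $ m $ n) = q n) \<and>
      (\<Sum>m\<in>UNIV. \<Sum>n\<in>UNIV. snd x $ m $ n) = 1 - \<alpha> \<and>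
      (\<forall>m n. 0 \<le> snd x $ m $ n \<and> snd x $ m $ n \<le> fst x $ m $ n)}"
    by (auto simp: LP_feasible_def)
  show "closed (Collect (LP_feasible \<alpha> p q))"
    unfolding eq
    by (intro closed_Collect_conj closed_Collect_all closed_Collect_eq closed_Collect_le
        continuous_intros)
  \<comment> \<open>A nonnegative entry is at most its row sum, so \<open>p m\<close> bounds row
    \<open>m\<close> of \<open>\<psi>\<close> and therefore also of \<open>\<mu>\<close>.\<close>
  let ?B = "cbox 0 (\<chi> m n. p m) :: (real ^ 'n ^ 'm) set"
  have "Collect (LP_feasible \<alpha> p q) \<subseteq> ?B \<times> ?B"
  proof (clarify)
    fix \<psi> \<mu> :: "real ^ 'n ^ 'm"
    assume feas: "LP_feasible \<alpha> p q (\<psi>, \<mu>)"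
    then have \<mu>: "0 \<le> \<mu> $ m $ n" "\<mu> $ m $ n \<le> \<psi> $ m $ n" for m n
      by (auto simp: LP_feasible_def)
    then have nn: "0 \<le> \<psi> $ m $ n" for m n
      by (meson order_trans)
    have "\<psi> $ m $ n \<le> p m" for m n
      using member_le_sum[of n UNIV "\<lambda>n. \<psi> $ m $ n"] nn feas by (simp add: LP_feasible_def)
    moreover from this \<mu>(2) have "\<mu> $ m $ n \<le> p m" for m n
      by (meson order_trans)
    ultimately show "\<psi> \<in> ?B \<and> \<mu> \<in> ?B"
      using \<mu>(1) nn by (auto simp: mem_box Basis_vec_def inner_axis)
  qed
  then show "bounded (Collect (LP_feasible \<alpha> p q))"
    by (rule bounded_subset[rotated]) (intro bounded_Times bounded_cbox)
qed

lemma LP_arg_max_exists: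
  fixes P :: "'m::finite pmf" and Q :: "'n::finite pmf"
  assumes \<alpha>: "0 < \<alpha>" "\<alpha> < 1"
  obtains \<psi> \<mu> where "is_arg_max (LP_objective \<alpha> \<Lambda>) (LP_feasible \<alpha> (pmf P) (pmf Q)) (\<psi>, \<mu>)"
proof -
  \<comment> \<open>The independent coupling, with the weights that attain its CVaR, is a feasible
    point.\<close>
  have "pair_pmf P Q \<in> Frechet_class P Q"
    by (simp add: Frechet_class_def map_fst_pair_pmf map_snd_pair_pmf)
  then have ne: "Collect (LP_feasible \<alpha> (pmf P) (pmf Q)) \<noteq> {}"
    using joint_CVaR_eq_LP_objective[OF \<alpha>] by (metis empty_iff mem_Collect_eq)
  have "LP_objective \<alpha> \<Lambda> = (\<lambda>x. 1 / (1 - \<alpha>) * (\<Sum>m\<in>UNIV. \<Sum>n\<in>UNIV. \<Lambda> m n * snd x $ m $ n))"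
    by (auto simp: LP_objective_def)
  then have "continuous_on (Collect (LP_feasible \<alpha> (pmf P) (pmf Q))) (LP_objective \<alpha> \<Lambda>)"
    by (simp only:) (intro continuous_intros)
  from continuous_attains_sup[OF compact_LP_feasible ne this] show thesis
    using that by (force simp: is_arg_max_linorder)
qed

text \<open>For any coupling \<open>R'\<close> with attaining weights \<open>\<mu>'\<close>, CVaR of
  \<open>R'\<close> equals the objective at (\<open>R'\<close>, \<open>\<mu>'\<close>), which is at
  most the optimum at (\<open>R\<close>, \<open>\<mu>\<close>), which is at most CVaR of
  \<open>R\<close>. Taking \<open>R' = R\<close> forces equality of the values.\<close>

lemma LP_arg_max_imp_worst_case:
  fixes R :: "('m::finite \<times> 'n::finite) pmf"
  assumes \<alpha>: "0 < \<alpha>" "\<alpha> < 1" and R: "R \<in> Frechet_class P Q"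
    and max: "is_arg_max (LP_objective \<alpha> \<Lambda>) (LP_feasible \<alpha> (pmf P) (pmf Q)) (\<chi> i j. pmf R (i, j), \<mu>)"
  shows "is_arg_max (joint_CVaR \<Lambda> \<alpha>) (\<lambda>R. R \<in> Frechet_class P Q) R"
    and "joint_CVaR \<Lambda> \<alpha> R = LP_objective \<alpha> \<Lambda> (\<chi> i j. pmf R (i, j), \<mu>)"
proof -
  have le: "joint_CVaR \<Lambda> \<alpha> R' \<le> LP_objective \<alpha> \<Lambda> (\<chi> i j. pmf R (i, j), \<mu>)"
    if "R' \<in> Frechet_class P Q" for R'
    using joint_CVaR_eq_LP_objective[OF \<alpha> that, of \<Lambda>] max
    by (metis is_arg_max_linorder)
  have ge: "LP_objective \<alpha> \<Lambda> (\<chi> i j. pmf R (i, j), \<mu>) \<le> joint_CVaR \<Lambda> \<alpha> R"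
    using max by (intro LP_objective_le_joint_CVaR[OF \<alpha>]) (auto simp: is_arg_max_def)
  show "joint_CVaR \<Lambda> \<alpha> R = LP_objective \<alpha> \<Lambda> (\<chi> i j. pmf R (i, j), \<mu>)"
    using le[OF R] ge by simp
  show "is_arg_max (joint_CVaR \<Lambda> \<alpha>) (\<lambda>R. R \<in> Frechet_class P Q) R"
    using R le ge by (force simp: is_arg_max_linorder)
qed

section \<open>From couplings of indices to joint distributions of the random vectors\<close>

theorem mainTheorem1:
  fixes \<alpha> :: real
    and F\<^sub>Y :: "(real ^ 'k) pmf" and F\<^sub>Z :: "(real ^ 'l) pmf"
    and y :: "'m::finite \<Rightarrow> real ^ 'k" and z :: "'n::finite \<Rightarrow> real ^ 'l"
    and p :: "'m \<Rightarrow> real" and q :: "'n \<Rightarrow> real"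
    and L :: "real ^ 'k \<Rightarrow> real ^ 'l \<Rightarrow> real"
  assumes "0 < \<alpha>" and "\<alpha> < 1"
    and "inj y" and "inj z"
    and "\<And>m. pmf F\<^sub>Y (y m) = p m" and "\<And>n. pmf F\<^sub>Z (z n) = q n"
    and "\<And>m. p m \<ge> 0" and "\<And>n. q n \<ge> 0"
    and "(\<Sum>m\<in>UNIV. p m) = 1" and "(\<Sum>n\<in>UNIV. q n) = 1"
  shows
    "(\<exists>\<Psi> \<psi> \<mu>.
        is_arg_max (joint_CVaR L \<alpha>) (\<lambda>\<Psi>. \<Psi> \<in> Frechet_class F\<^sub>Y F\<^sub>Z) \<Psi> \<and>
        is_arg_max (LP_objective \<alpha> (\<lambda>m n. L (y m) (z n))) (LP_feasible \<alpha> p q) (\<psi>, \<mu>) \<and>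
        joint_CVaR L \<alpha> \<Psi> = LP_objective \<alpha> (\<lambda>m n. L (y m) (z n)) (\<psi>, \<mu>)) \<and>
     (\<forall>\<psi> \<mu>.
        is_arg_max (LP_objective \<alpha> (\<lambda>m n. L (y m) (z n))) (LP_feasible \<alpha> p q) (\<psi>, \<mu>) \<longrightarrow>
        (\<exists>\<Psi>. joint_matrix y z \<Psi> = \<psi> \<and>
             is_arg_max (joint_CVaR L \<alpha>) (\<lambda>\<Psi>. \<Psi> \<in> Frechet_class F\<^sub>Y F\<^sub>Z) \<Psi>))"
proof -
  let ?\<Lambda> = "\<lambda>m n. L (y m) (z n)"
  obtain P where P: "F\<^sub>Y = map_pmf y P" "pmf P = p"
    using ex_pmf_on_indices[of y F\<^sub>Y p] assms by metis
  obtain Q where Q: "F\<^sub>Z = map_pmf z Q" "pmf Q = q"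
    using ex_pmf_on_indices[of z F\<^sub>Z q] assms by metis
  \<comment> \<open>Carrying the equality of values along makes this serve both claims: applied to
    any one optimum of the program, it also yields the common optimal value.\<close>
  have worst: "\<exists>\<Psi>. joint_matrix y z \<Psi> = \<psi> \<and>
      is_arg_max (joint_CVaR L \<alpha>) (\<lambda>\<Psi>. \<Psi> \<in> Frechet_class F\<^sub>Y F\<^sub>Z) \<Psi> \<and>
      joint_CVaR L \<alpha> \<Psi> = LP_objective \<alpha> ?\<Lambda> (\<psi>, \<mu>)"
    if max: "is_arg_max (LP_objective \<alpha> ?\<Lambda>) (LP_feasible \<alpha> p q) (\<psi>, \<mu>)" for \<psi> \<mu>
  proof -
    have "LP_feasible \<alpha> (pmf P) (pmf Q) (\<psi>, \<mu>)"
      using max by (simp add: is_arg_max_def P Q)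
    then obtain R where R: "R \<in> Frechet_class P Q" "\<psi> = (\<chi> i j. pmf R (i, j))"
      by (rule LP_feasible_coupling)
    note opt = LP_arg_max_imp_worst_case[OF assms(1,2) R(1) max[folded P(2) Q(2), unfolded R(2)]]
    let ?\<Psi> = "map_pmf (map_prod y z) R"
    have "is_arg_max (joint_CVaR L \<alpha>) (\<lambda>\<Psi>. \<Psi> \<in> Frechet_class F\<^sub>Y F\<^sub>Z) ?\<Psi>"
      using opt(1) unfolding P(1) Q(1) Frechet_class_map_pmf[OF assms(3,4)]
      by (auto simp: is_arg_max_linorder joint_CVaR_map_pmf)
    then show ?thesis
      using opt(2) R(2) joint_matrix_map_pmf[OF assms(3,4), of R] joint_CVaR_map_pmf[of L \<alpha> y z R]
      by auto
  qed
  obtain \<psi> \<mu> where "is_arg_max (LP_objective \<alpha> ?\<Lambda>) (LP_feasible \<alpha> p q) (\<psi>, \<mu>)"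
    using LP_arg_max_exists[OF assms(1,2), of ?\<Lambda> P Q] unfolding P(2) Q(2) by blast
  with worst show ?thesis
    by meson
qed

end
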